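(* The function $\beta\mapsto h_c(\beta)$ is not necessarily non-decreasing; that is, there exist $k\in\mathbb N$, distinct $a_1,\dots,a_k\in[0,\infty)$ and $\omega_1,\dots,\omega_k\in(0,1)$ with $\sum_{\ell}\omega_\ell=1$ for which $\beta\mapsto h_c(\beta)$ is not non-decreasing on $(\beta_c,\infty)$.
   Context: For $\beta>0$, $h\ge0$ and $K\in\mathbb R$, $T_{\beta,h}(K)=\sum_{\ell=1}^k a_\ell\omega_\ell\tanh(\beta[a_\ell K+h])$. The pair $(\beta,h)$ is called metastable if the equation $K=T_{\beta,h}(K)$ has more than one solution at which $T_{\beta,h}$ is not tangent to the diagonal. $\beta_c=\left[\sum_{\ell}a_\ell^2\omega_\ell\right]^{-1}$, and for $\beta>\beta_c$ the critical magnetic field $h_c(\beta)$ is the minimal value of $h\ge0$ for which $(\beta,h)$ is not metastable. *)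

theory Defs
  imports "HOL-Analysis.Analysis"
begin

text \<open>Levels \<open>a l\<close> and weights \<open>w l\<close> are indexed by \<open>l \<in> {1..k}\<close>; values outside this range are
  irrelevant.\<close>

definition T :: "nat \<Rightarrow> (nat \<Rightarrow> real) \<Rightarrow> (nat \<Rightarrow> real) \<Rightarrow> real \<Rightarrow> real \<Rightarrow> real \<Rightarrow> real" where
  "T k a w \<beta> h K = (\<Sum>l=1..k. a l * w l * tanh (\<beta> * (a l * K + h)))"

text \<open>The graph of \<open>T\<close> is tangent to the diagonal at a fixed point \<open>K\<close> iff its slope there is \<open>1\<close>.\<close>

definition nontangent_solution ::
    "nat \<Rightarrow> (nat \<Rightarrow> real) \<Rightarrow> (nat \<Rightarrow> real) \<Rightarrow> real \<Rightarrow> real \<Rightarrow> real \<Rightarrow> bool" where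
  "nontangent_solution k a w \<beta> h K \<longleftrightarrow>
     K = T k a w \<beta> h K \<and> deriv (T k a w \<beta> h) K \<noteq> 1"

definition metastable ::
    "nat \<Rightarrow> (nat \<Rightarrow> real) \<Rightarrow> (nat \<Rightarrow> real) \<Rightarrow> real \<Rightarrow> real \<Rightarrow> bool" where
  "metastable k a w \<beta> h \<longleftrightarrow>
     (\<exists>K1 K2. K1 \<noteq> K2 \<and> nontangent_solution k a w \<beta> h K1 \<and> nontangent_solution k a w \<beta> h K2)"

definition beta_c :: "nat \<Rightarrow> (nat \<Rightarrow> real) \<Rightarrow> (nat \<Rightarrow> real) \<Rightarrow> real" where
  "beta_c k a w = inverse (\<Sum>l=1..k. (a l)\<^sup>2 * w l)"

text \<open>Only meaningful for \<open>\<beta> > beta_c k a w\<close>.\<close>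

definition h_c :: "nat \<Rightarrow> (nat \<Rightarrow> real) \<Rightarrow> (nat \<Rightarrow> real) \<Rightarrow> real \<Rightarrow> real" where
  "h_c k a w \<beta> = (LEAST h. h \<ge> 0 \<and> \<not> metastable k a w \<beta> h)"

end

theory Submission
  imports Defs
begin

text \<open>
  Take one species with a very large level and tiny weight, and one with a small level and almost
  all of the weight: \<open>a = (1000, 2)\<close>, \<open>w = (1/1000, 999/1000)\<close>, so that
  \<open>T(K) = tanh (\<beta> (1000 K + h)) + 1.998 tanh (\<beta> (2 K + h))\<close>.
  The second term is nearly independent of \<open>K\<close> and acts as an additional field of strength about
  \<open>1.998 tanh (\<beta> h)\<close>. At high temperature this is small, and the negative solution of the
  Curie--Weiss-like first term survives for all fields up to \<open>h = 20\<close> (\<open>\<beta> = 1/500\<close>).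
  At low temperature (\<open>\<beta> = 1/20\<close>) the additional field exceeds \<open>1\<close> already at \<open>h = 20\<close> and
  destroys every nonpositive solution. Positive solutions are always unique because
  \<open>T(K) / K\<close> is strictly decreasing.
\<close>

subsection \<open>The hyperbolic tangent\<close>

lemma tanh_real_has_derivative:
  "((tanh :: real \<Rightarrow> real) has_real_derivative 1 - (tanh x)\<^sup>2) (at x)"
  by (auto intro!: derivative_eq_intros simp: less_imp_neq[OF cosh_real_pos, symmetric])

lemma tanh_real_square_less_1: "(tanh (x::real))\<^sup>2 < 1"
  using tanh_real_bounds[of x] by (simp add: abs_square_less_1 abs_less_iff)

lemma tanh_real_le_self: "tanh x \<le> x" if "0 \<le> x" for x :: real
proof -
  have "((\<lambda>x. x - tanh x) has_real_derivative (tanh x)\<^sup>2) (at x)" for x :: real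
    using DERIV_diff[OF DERIV_ident tanh_real_has_derivative, of x] by simp
  then have "0 - tanh 0 \<le> x - tanh x"
    by (intro DERIV_nonneg_imp_nondecreasing[OF that, of "\<lambda>x. x - tanh x"])
      (meson zero_le_power2)
  then show ?thesis by simp
qed

text \<open>Both sides agree at 0, and their difference has derivative
  \<open>2 * z * tanh z * (1 - (tanh z)\<^sup>2)\<close>, positive for positive \<open>z\<close>.
  Equivalently, \<open>tanh z / z\<close> is strictly decreasing there.\<close>

lemma self_times_tanh_deriv_less_tanh:
  "z * (1 - (tanh z)\<^sup>2) < tanh z" if "0 < z" for z :: real
proof -
  let ?f = "\<lambda>z::real. tanh z - z * (1 - (tanh z)\<^sup>2)"
  have der: "(?f has_real_derivative 2 * z * tanh z * (1 - (tanh z)\<^sup>2)) (at z)" for z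
    by (rule derivative_eq_intros tanh_real_has_derivative refl)+
      (simp add: algebra_simps power2_eq_square)
  have "?f 0 < ?f z"
  proof (rule DERIV_pos_imp_increasing_open[OF that])
    fix x :: real assume "0 < x" "x < z"
    then have "0 < 2 * x * tanh x * (1 - (tanh x)\<^sup>2)"
      using tanh_real_square_less_1[of x] by simp
    then show "\<exists>y. (?f has_real_derivative y) (at x) \<and> 0 < y"
      using der by blast
  next
    show "continuous_on {0..z} ?f"
      by (intro continuous_at_imp_continuous_on ballI DERIV_isCont[OF der])
  qed
  then show ?thesis by simp
qed

text \<open>Turns numerical lower bounds on \<open>tanh\<close> into lower bounds on
  \<open>exp\<close>, which Taylor polynomials supply.\<close>

lemma tanh_real_greater_iff_exp:
  "y < tanh x \<longleftrightarrow> y * (1 + exp (2 * x)) < exp (2 * x) - 1" for x y :: real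
proof -
  have "tanh x = (exp (2 * x) - 1) / (1 + exp (2 * x))"
  proof -
    have "(1 - inverse E) / (1 + inverse E) = (E - 1) / (1 + E)" if "0 < E" for E :: real
      using that by (simp add: divide_simps)
    from this[OF exp_gt_zero[of "2 * x"]] show ?thesis
      by (simp add: tanh_real_altdef exp_minus)
  qed
  moreover have "0 < 1 + exp (2 * x)"
    by (simp add: add_pos_pos)
  ultimately show ?thesis
    by (simp add: pos_less_divide_eq)
qed

lemma tanh_48_50_gt: "71/100 < tanh (48/50 :: real)"
proof -
  \<comment> \<open>The quadratic Taylor bound at 48/25 itself would only give about 0.65, so it is
    applied at a quarter of that exponent and raised to the fourth power.\<close>
  have "(159/100)^4 \<le> exp (12/25 :: real) ^ 4"
    using exp_lower_Taylor_quadratic[of "12/25"]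
    by (intro power_mono) (auto simp: power2_eq_square)
  also have "\<dots> = exp (2 * (48/50))"
    by (simp flip: exp_of_nat_mult)
  finally show ?thesis
    unfolding tanh_real_greater_iff_exp by (simp add: power4_eq_xxxx)
qed

lemma tanh_7_10_gt: "51/100 < tanh (7/10 :: real)"
  using exp_lower_Taylor_quadratic[of "7/5"]
  unfolding tanh_real_greater_iff_exp by (simp add: power2_eq_square)

lemma tanh_1_5_gt: "1/10 < tanh (1/5 :: real)"
  using exp_ge_add_one_self[of "2/5"]
  unfolding tanh_real_greater_iff_exp by simp

subsection \<open>The fixed-point equation\<close>

definition dT :: "nat \<Rightarrow> (nat \<Rightarrow> real) \<Rightarrow> (nat \<Rightarrow> real) \<Rightarrow> real \<Rightarrow> real \<Rightarrow> real \<Rightarrow> real" where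
  "dT k a w \<beta> h K =
     (\<Sum>l=1..k. a l * w l * (\<beta> * a l) * (1 - (tanh (\<beta> * (a l * K + h)))\<^sup>2))"

lemma T_has_derivative: "(T k a w \<beta> h has_real_derivative dT k a w \<beta> h K) (at K)"
proof -
  have "((\<lambda>K. a l * w l * tanh (\<beta> * (a l * K + h))) has_real_derivative
      a l * w l * (\<beta> * a l) * (1 - (tanh (\<beta> * (a l * K + h)))\<^sup>2)) (at K)" for l
  proof -
    have "((\<lambda>K. \<beta> * (a l * K + h)) has_real_derivative \<beta> * a l) (at K)"
      by (auto intro!: derivative_eq_intros)
    from DERIV_chain2[OF tanh_real_has_derivative this]
    have "((\<lambda>K. tanh (\<beta> * (a l * K + h))) has_real_derivative
        (1 - (tanh (\<beta> * (a l * K + h)))\<^sup>2) * (\<beta> * a l)) (at K)" .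
    from DERIV_cmult[OF this, of "a l * w l"] show ?thesis
      by (simp add: mult_ac)
  qed
  then show ?thesis
    unfolding T_def[abs_def] dT_def by (intro DERIV_sum)
qed

lemma nontangent_solution_iff:
  "nontangent_solution k a w \<beta> h K \<longleftrightarrow> T k a w \<beta> h K = K \<and> dT k a w \<beta> h K \<noteq> 1"
  using DERIV_imp_deriv[OF T_has_derivative] by (auto simp: nontangent_solution_def)

lemma continuous_on_T: "continuous_on S (T k a w \<beta> h)"
  by (intro continuous_at_imp_continuous_on ballI DERIV_isCont[OF T_has_derivative])

section \<open>Persistence of nontangent solutions in \<open>h\<close>, and attainment of the
  minimum defining \<open>h_c\<close>\<close>

lemma cosh_real_neq_0: "cosh (x::real) \<noteq> 0"
  using cosh_real_pos[of x] by simp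

lemma T_crossing:
  assumes "x \<le> y" "(T k a w \<beta> h x - x) * (T k a w \<beta> h y - y) < 0"
  obtains K where "x < K" "K < y" "T k a w \<beta> h K = K"
proof -
  let ?F = "\<lambda>K. T k a w \<beta> h K - K"
  have cont: "continuous_on {x..y} ?F"
    by (intro continuous_intros continuous_on_T)
  have "\<exists>K. x \<le> K \<and> K \<le> y \<and> ?F K = 0"
  proof (cases "?F x < 0")
    case True
    then have "?F y > 0" using assms(2) by (simp add: mult_less_0_iff)
    then show ?thesis using True IVT'[OF _ _ assms(1) cont, of 0] by auto
  next
    case False
    then have "?F x > 0" "?F y < 0" using assms(2) by (auto simp: mult_less_0_iff)
    then show ?thesis using IVT2'[OF _ _ assms(1) cont, of 0] by auto
  qed
  then obtain K where K: "x \<le> K" "K \<le> y" "?F K = 0" by blast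
  with assms(2) have "K \<noteq> x" "K \<noteq> y" by auto
  with K show thesis by (intro that[of K]) auto
qed

text \<open>At a nontangent solution \<open>T - K\<close> changes sign strictly, and this survives a
  small change of \<open>h\<close>. Slope different from 1 is an open condition in
  \<open>(h, K)\<close>, so the new crossing is again nontangent.\<close>

lemma nontangent_solution_persists:
  assumes "nontangent_solution k a w \<beta> h0 K0" "0 < \<delta>"
  shows "\<forall>\<^sub>F h in nhds h0. \<exists>K. \<bar>K - K0\<bar> < \<delta> \<and> nontangent_solution k a w \<beta> h K"
proof -
  let ?D = "\<lambda>p. dT k a w \<beta> (fst p) (snd p)"
  have fix0: "T k a w \<beta> h0 K0 = K0" and slope0: "dT k a w \<beta> h0 K0 \<noteq> 1"
    using assms(1) by (auto simp: nontangent_solution_iff)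
  have "continuous_on UNIV ?D"
    unfolding dT_def by (intro continuous_intros) (auto simp: cosh_real_neq_0)
  then have "open {p. ?D p \<noteq> 1}"
    by (intro open_Collect_neq continuous_intros) auto
  then obtain A B where AB: "open A" "open B" "h0 \<in> A" "K0 \<in> B" "A \<times> B \<subseteq> {p. ?D p \<noteq> 1}"
    using slope0 by (elim open_prod_elim[where x = "(h0, K0)"]) auto
  obtain e where e: "0 < e" "ball K0 e \<subseteq> B"
    using AB openE by blast
  \<comment> \<open>The sign makes \<open>F h0\<close> increase through \<open>K0\<close> whether
    the slope of \<open>T\<close> lies above or below 1.\<close>
  define \<sigma> where "\<sigma> = sgn (dT k a w \<beta> h0 K0 - 1)"
  define F where "F h K = \<sigma> * (T k a w \<beta> h K - K)" for h K
  have \<sigma>: "\<sigma> = 1 \<or> \<sigma> = -1"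
    using slope0 by (auto simp: \<sigma>_def sgn_if)
  have der: "(F h0 has_real_derivative \<bar>dT k a w \<beta> h0 K0 - 1\<bar>) (at K0)"
    unfolding F_def[abs_def] abs_sgn \<sigma>_def mult.commute[of _ "sgn _"]
    by (intro DERIV_cmult DERIV_diff T_has_derivative DERIV_ident)
  obtain d1 where d1: "d1 > 0" "\<And>r. 0 < r \<Longrightarrow> r < d1 \<Longrightarrow> F h0 K0 < F h0 (K0 + r)"
    using DERIV_pos_inc_right[OF der] slope0 by auto
  obtain d2 where d2: "d2 > 0" "\<And>r. 0 < r \<Longrightarrow> r < d2 \<Longrightarrow> F h0 (K0 - r) < F h0 K0"
    using DERIV_pos_inc_left[OF der] slope0 by auto
  define r where "r = Min {d1, d2, e, \<delta>} / 2"
  have r: "0 < r" "r < d1" "r < d2" "r < e" "r < \<delta>"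
    using d1(1) d2(1) e(1) assms(2) by (auto simp: r_def min_def)
  have F0: "F h0 K0 = 0" using fix0 by (simp add: F_def)
  have cont: "((\<lambda>h. F h K) \<longlongrightarrow> F h0 K) (nhds h0)" for K
    unfolding F_def T_def
    by (intro tendsto_intros filterlim_ident) (auto simp: cosh_real_neq_0)
  have "\<forall>\<^sub>F h in nhds h0. 0 < F h (K0 + r)"
    using d1(2)[of r] r F0 by (intro order_tendstoD(1)[OF cont]) auto
  moreover have "\<forall>\<^sub>F h in nhds h0. F h (K0 - r) < 0"
    using d2(2)[of r] r F0 by (intro order_tendstoD(2)[OF cont]) auto
  moreover have "\<forall>\<^sub>F h in nhds h0. h \<in> A"
    using AB eventually_nhds by blast
  ultimately show ?thesis
  proof eventually_elim
    case (elim h)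
    have "F h (K0 - r) * F h (K0 + r) < 0"
      using elim by (simp add: mult_neg_pos)
    then have "(T k a w \<beta> h (K0 - r) - (K0 - r)) * (T k a w \<beta> h (K0 + r) - (K0 + r)) < 0"
      using \<sigma> by (elim disjE) (simp_all only: F_def mult_minus1 minus_mult_minus mult_1)
    then obtain K where K: "K0 - r < K" "K < K0 + r" "T k a w \<beta> h K = K"
      by (rule T_crossing[rotated]) (use r(1) in auto)
    then have "\<bar>K - K0\<bar> < r" by auto
    then have "K \<in> B" using e(2) r(4) by (auto simp: dist_real_def subset_iff)
    then have "nontangent_solution k a w \<beta> h K"
      using AB(5) K(3) elim(3) by (auto simp: nontangent_solution_iff)
    with \<open>\<bar>K - K0\<bar> < r\<close> r(5) show ?case by (intro exI[of _ K]) auto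
  qed
qed

lemma open_metastable: "open {h. metastable k a w \<beta> h}"
  unfolding open_contains_ball
proof -
  have "\<forall>\<^sub>F h in nhds h0. metastable k a w \<beta> h" if meta: "metastable k a w \<beta> h0" for h0
  proof -
    obtain K1 K2 where K: "K1 \<noteq> K2" "nontangent_solution k a w \<beta> h0 K1"
      "nontangent_solution k a w \<beta> h0 K2"
      using meta unfolding metastable_def by blast
    \<comment> \<open>Half the distance, so that the two perturbed solutions cannot
      coincide.\<close>
    define \<delta> where "\<delta> = \<bar>K1 - K2\<bar> / 2"
    have "0 < \<delta>" using K(1) by (simp add: \<delta>_def)
    from nontangent_solution_persists[OF K(2) this] nontangent_solution_persists[OF K(3) this]
    show ?thesis
    proof eventually_elim
      case (elim h)
      then obtain K1' K2' where "\<bar>K1' - K1\<bar> < \<delta>" "nontangent_solution k a w \<beta> h K1'"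
        "\<bar>K2' - K2\<bar> < \<delta>" "nontangent_solution k a w \<beta> h K2'" by blast
      moreover from this have "K1' \<noteq> K2'" unfolding \<delta>_def by argo
      ultimately show ?case unfolding metastable_def by blast
    qed
  qed
  then show "\<forall>x\<in>{h. metastable k a w \<beta> h}. \<exists>e>0. ball x e \<subseteq> {h. metastable k a w \<beta> h}"
    unfolding eventually_nhds_metric by (simp add: subset_iff dist_commute)
qed

text \<open>\<open>LEAST\<close> over the reals is informative only if the minimum exists. By
  openness of metastability, the non-metastable \<open>h \<ge> 0\<close> form a closed set, so one
  witness suffices.\<close>

lemma h_c_attained:
  assumes "0 \<le> h" "\<not> metastable k a w \<beta> h"
  shows "0 \<le> h_c k a w \<beta>" "\<not> metastable k a w \<beta> (h_c k a w \<beta>)" "h_c k a w \<beta> \<le> h"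
proof -
  define S where "S = {0..} \<inter> - {h. metastable k a w \<beta> h}"
  have S: "h \<in> S" "bdd_below S" "closed S"
    using assms closed_Int[OF closed_atLeast closed_Compl[OF open_metastable]]
    unfolding S_def by auto
  have mem: "Inf S \<in> S"
    using closed_contains_Inf[OF _ S(2,3)] S(1) by blast
  have "h_c k a w \<beta> = Inf S"
    unfolding h_c_def
  proof (rule Least_equality)
    show "0 \<le> Inf S \<and> \<not> metastable k a w \<beta> (Inf S)"
      using mem by (simp add: S_def)
    show "Inf S \<le> y" if "0 \<le> y \<and> \<not> metastable k a w \<beta> y" for y
      using that S(2) by (intro cInf_lower) (auto simp: S_def)
  qed
  with mem cInf_lower[OF S(1,2)]
  show "0 \<le> h_c k a w \<beta>" "\<not> metastable k a w \<beta> (h_c k a w \<beta>)" "h_c k a w \<beta> \<le> h"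
    by (auto simp: S_def)
qed

section \<open>Uniqueness of positive solutions\<close>

context
  fixes k :: nat and a w :: "nat \<Rightarrow> real" and \<beta> h :: real
  assumes k: "1 \<le> k" and a: "\<And>l. l \<in> {1..k} \<Longrightarrow> 0 < a l" and w: "\<And>l. l \<in> {1..k} \<Longrightarrow> 0 < w l"
    and \<beta>: "0 < \<beta>" and h: "0 \<le> h"
begin

text \<open>Holds term by term: with \<open>z = \<beta> * (a l * K + h)\<close>, the field
  \<open>h \<ge> 0\<close> gives \<open>K * (\<beta> * a l) \<le> z\<close>, and then
  \<open>z * (1 - (tanh z)\<^sup>2) < tanh z\<close> applies. It makes the derivative of
  \<open>T / K\<close> negative.\<close>

lemma times_dT_less_T:
  assumes "0 < K"
  shows "K * dT k a w \<beta> h K < T k a w \<beta> h K"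
  unfolding dT_def T_def sum_distrib_left
proof (rule sum_strict_mono)
  fix l assume l: "l \<in> {1..k}"
  define z where "z = \<beta> * (a l * K + h)"
  have z: "0 < z"
    using a[OF l] \<beta> h assms unfolding z_def by (intro mult_pos_pos add_pos_nonneg) auto
  have aw: "0 < a l * w l" using a[OF l] w[OF l] by simp
  have "K * (\<beta> * a l) \<le> z" using \<beta> h by (simp add: z_def algebra_simps)
  then have "K * (\<beta> * a l) * (1 - (tanh z)\<^sup>2) \<le> z * (1 - (tanh z)\<^sup>2)"
    using tanh_real_square_less_1[of z] by (intro mult_right_mono) auto
  also have "\<dots> < tanh z" by (rule self_times_tanh_deriv_less_tanh[OF z])
  finally have "a l * w l * (K * (\<beta> * a l) * (1 - (tanh z)\<^sup>2)) < a l * w l * tanh z"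
    using aw by (rule mult_strict_left_mono)
  then show "K * (a l * w l * (\<beta> * a l) * (1 - (tanh (\<beta> * (a l * K + h)))\<^sup>2))
      < a l * w l * tanh (\<beta> * (a l * K + h))"
    unfolding z_def by (simp add: mult_ac)
qed (use k in auto)

lemma nontangent_of_pos_solution:
  assumes "0 < K" "T k a w \<beta> h K = K"
  shows "nontangent_solution k a w \<beta> h K"
  using times_dT_less_T[OF assms(1)] assms by (auto simp: nontangent_solution_iff)

lemma T_over_self_decreasing:
  assumes "0 < x" "x < y"
  shows "T k a w \<beta> h y / y < T k a w \<beta> h x / x"
proof (rule DERIV_neg_imp_decreasing[OF assms(2)])
  fix K assume "x \<le> K" "K \<le> y"
  then have K: "0 < K" using assms by simp
  have "((\<lambda>K. T k a w \<beta> h K / K) has_real_derivative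
      (dT k a w \<beta> h K * K - T k a w \<beta> h K * 1) / (K * K)) (at K)"
    using K by (intro DERIV_divide T_has_derivative DERIV_ident) auto
  moreover have "(dT k a w \<beta> h K * K - T k a w \<beta> h K * 1) / (K * K) < 0"
    using times_dT_less_T[OF K] K by (intro divide_neg_pos) (auto simp: mult.commute)
  ultimately show "\<exists>D. ((\<lambda>K. T k a w \<beta> h K / K) has_real_derivative D) (at K) \<and> D < 0"
    by blast
qed

lemma pos_solution_unique:
  assumes "0 < x" "T k a w \<beta> h x = x" "0 < y" "T k a w \<beta> h y = y"
  shows "x = y"
  using T_over_self_decreasing[of x y] T_over_self_decreasing[of y x] assms
  by (cases x y rule: linorder_cases) auto

lemma not_metastable_if_no_nonpos_solution:
  assumes "\<And>K. K \<le> 0 \<Longrightarrow> T k a w \<beta> h K \<noteq> K"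
  shows "\<not> metastable k a w \<beta> h"
  using pos_solution_unique assms unfolding metastable_def nontangent_solution_iff
  by (meson not_le)

end

subsection \<open>The counterexample\<close>

definition lev :: "nat \<Rightarrow> real" where
  "lev l = (if l = 1 then 1000 else 2)"

definition wgt :: "nat \<Rightarrow> real" where
  "wgt l = (if l = 1 then 1/1000 else 999/1000)"

lemma lev_pos: "0 < lev l" and wgt_pos: "0 < wgt l"
  by (auto simp: lev_def wgt_def)

lemma atLeastAtMost_Suc_0_2: "{Suc 0..2} = {Suc 0, 2}"
  by auto

lemma T_lev_wgt:
  "T 2 lev wgt \<beta> h K = tanh (\<beta> * (1000 * K + h)) + 999/500 * tanh (\<beta> * (2 * K + h))"
  by (simp add: T_def atLeastAtMost_Suc_0_2 lev_def wgt_def)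

lemma dT_lev_wgt:
  "dT 2 lev wgt \<beta> h K = 1000 * \<beta> * (1 - (tanh (\<beta> * (1000 * K + h)))\<^sup>2)
     + 999/250 * \<beta> * (1 - (tanh (\<beta> * (2 * K + h)))\<^sup>2)"
  by (simp add: dT_def atLeastAtMost_Suc_0_2 lev_def wgt_def)

lemma T_lev_wgt_bounds: "-3 < T 2 lev wgt \<beta> h K" "T 2 lev wgt \<beta> h K < 3"
  using tanh_real_bounds[of "\<beta> * (1000 * K + h)"] tanh_real_bounds[of "\<beta> * (2 * K + h)"]
  by (auto simp: T_lev_wgt)

lemma not_metastable_strong_field:
  assumes "0 < \<beta>" "0 \<le> h" "7/10 \<le> \<beta> * (h - 6)"
  shows "\<not> metastable 2 lev wgt \<beta> h"
proof (rule not_metastable_if_no_nonpos_solution)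
  fix K :: real assume K: "K \<le> 0"
  show "T 2 lev wgt \<beta> h K \<noteq> K"
  \<comment> \<open>Every value of \<open>T\<close> exceeds -3, so no solution lies below -3. On
    \<open>[-3, 0]\<close> the second term exceeds 1.998 * 0.51 > 1, which outweighs the first term
    and makes \<open>T\<close> positive.\<close>
  proof (cases "-3 \<le> K")
    case True
    then have "\<beta> * (h - 6) \<le> \<beta> * (2 * K + h)"
      using assms(1) by (intro mult_left_mono) auto
    with assms(3) have "tanh (7/10) \<le> tanh (\<beta> * (2 * K + h))"
      by simp
    with tanh_7_10_gt have "51/100 < tanh (\<beta> * (2 * K + h))" by linarith
    then show ?thesis
      using tanh_real_gt_neg1[of "\<beta> * (1000 * K + h)"] K by (simp add: T_lev_wgt)
  next
    case False
    then show ?thesis using T_lev_wgt_bounds(1)[of \<beta> h K] by auto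
  qed
qed (use assms in \<open>auto simp: lev_pos wgt_pos\<close>)

lemma metastable_weak_field:
  assumes "0 \<le> h" "h \<le> 20"
  shows "metastable 2 lev wgt (1/500) h"
proof -
  let ?T = "T 2 lev wgt (1/500) h"
  have big: "tanh (1/500 * (1000 * K + h)) < - (71/100)" if "K \<le> -1/2" for K
  proof -
    \<comment> \<open>The extreme case is \<open>K = -1/2\<close>, \<open>h = 20\<close>: the
      argument is (-500 + 20)/500.\<close>
    have "tanh (1/500 * (1000 * K + h)) \<le> tanh (- (48/50))"
      unfolding tanh_real_le_iff using that assms(2) by simp
    then show ?thesis using tanh_48_50_gt by simp
  qed
  have "tanh (1/500 * (2 * (-1/2) + h)) \<le> tanh (19/500)"
    unfolding tanh_real_le_iff using assms(2) by simp
  also have "\<dots> \<le> 19/500" by (rule tanh_real_le_self) simp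
  \<comment> \<open>The second term adds at most 1.998 * 19/500 < 0.08 to a first term below
    -0.71.\<close>
  finally have "?T (-1/2) < -1/2"
    using big[of "-1/2"] by (simp add: T_lev_wgt)
  then have "(?T (-3) - (-3)) * (?T (-1/2) - (-1/2)) < 0"
    using T_lev_wgt_bounds(1)[of "1/500" h "-3"] by (intro mult_pos_neg) auto
  then obtain K1 where K1: "-3 < K1" "K1 < -1/2" "?T K1 = K1"
    by (rule T_crossing[rotated]) auto
  define t where "t = tanh (1/500 * (1000 * K1 + h))"
  have "(71/100)\<^sup>2 < (- t)\<^sup>2"
    using big[of K1] K1 by (intro power_strict_mono) (auto simp: t_def)
  then have "5041/10000 < t\<^sup>2"
    by (simp add: power2_eq_square)
  moreover have "0 \<le> (tanh (1/500 * (2 * K1 + h)))\<^sup>2"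
    by simp
  \<comment> \<open>The slope is below 2 * (1 - 0.5041) + 0.008 = 0.9998; this narrow margin
    dictates the constant 71/100.\<close>
  ultimately have "dT 2 lev wgt (1/500) h K1 < 1"
    unfolding dT_lev_wgt t_def[symmetric] by argo
  then have ns1: "nontangent_solution 2 lev wgt (1/500) h K1"
    using K1 by (simp add: nontangent_solution_iff)
  have "tanh (1/5) \<le> tanh (1/500 * (1000 * (1/10) + h))"
    unfolding tanh_real_le_iff using assms(1) by simp
  moreover have "0 \<le> tanh (1/500 * (2 * (1/10) + h))"
    unfolding tanh_real_nonneg_iff using assms(1) by simp
  ultimately have "1/10 < ?T (1/10)"
    using tanh_1_5_gt unfolding T_lev_wgt by linarith
  then have "(?T (1/10) - 1/10) * (?T 3 - 3) < 0"
    using T_lev_wgt_bounds(2)[of "1/500" h 3] by (intro mult_pos_neg) auto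
  then obtain K2 where K2: "1/10 < K2" "K2 < 3" "?T K2 = K2"
    by (rule T_crossing[rotated]) auto
  have "nontangent_solution 2 lev wgt (1/500) h K2"
    using K2 assms(1) by (intro nontangent_of_pos_solution) (auto simp: lev_pos wgt_pos)
  moreover have "K1 \<noteq> K2" using K1 K2 by auto
  ultimately show ?thesis using ns1 unfolding metastable_def by blast
qed

theorem lemma3p5:
  "\<exists>(k::nat) (a::nat \<Rightarrow> real) (w::nat \<Rightarrow> real).
     inj_on a {1..k} \<and>
     (\<forall>l\<in>{1..k}. 0 \<le> a l) \<and>
     (\<forall>l\<in>{1..k}. 0 < w l \<and> w l < 1) \<and>
     (\<Sum>l=1..k. w l) = 1 \<and>
     \<not> mono_on {beta_c k a w<..} (h_c k a w)"
proof (intro exI conjI)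
  show "inj_on lev {1..2}" "(\<Sum>l=1..2. wgt l) = 1" "\<forall>l\<in>{1..2}. 0 \<le> lev l"
    "\<forall>l\<in>{1..2}. 0 < wgt l \<and> wgt l < 1"
    by (auto simp: atLeastAtMost_Suc_0_2 lev_def wgt_def)
  have "beta_c 2 lev wgt < 1/500"
    by (simp add: beta_c_def atLeastAtMost_Suc_0_2 lev_def wgt_def power2_eq_square)
  then have mem: "1/500 \<in> {beta_c 2 lev wgt<..}" "1/20 \<in> {beta_c 2 lev wgt<..}"
    by auto
  \<comment> \<open>Any sufficiently strong field would do: a non-metastable \<open>h\<close>
    ensures that \<open>h_c\<close> at 1/500 is attained. Being non-metastable, that minimum cannot
    lie in \<open>[0, 20]\<close>.\<close>
  have "\<not> metastable 2 lev wgt (1/500) 500"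
    by (rule not_metastable_strong_field) auto
  from h_c_attained(1,2)[OF _ this] have high: "20 < h_c 2 lev wgt (1/500)"
    using metastable_weak_field by (meson not_le zero_le_numeral)
  \<comment> \<open>Here (20 - 6)/20 is exactly the threshold 7/10 of the strong-field
    criterion.\<close>
  have "\<not> metastable 2 lev wgt (1/20) 20"
    by (rule not_metastable_strong_field) auto
  from h_c_attained(3)[OF _ this] have low: "h_c 2 lev wgt (1/20) \<le> 20"
    by simp
  show "\<not> mono_on {beta_c 2 lev wgt<..} (h_c 2 lev wgt)"
    using mono_onD[OF _ mem] high low by force
qed

end
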